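(* Let $X$ be an $(\mathcal{A},\mathcal{B})$-thick metric space. Assume that the subspaces in $\mathcal{A}$ are uniformly not coarsely separable by families of subexponential growth and that the subspaces in $\mathcal{B}$ have exponential growth. Then $X$ is not coarsely separable by a family of subexponential growth.
   Context: Thickness. Let $\mathcal{A},\mathcal{B}$ be two collections of subspaces of a metric space $X$. A subset $E \subseteq X$ is $(\mathcal{A},\mathcal{B})$-thick if, for all $x,y \in E$, there exist $A_1,\ldots,A_n \in \mathcal{A}$ such that $x \in A_1$, $y \in A_n$, and $A_i \cap A_{i+1}$ contains some $B \in \mathcal{B}$ for every $1 \leq i \leq n-1$. Coarse separation. For $Z \subseteq X$ and $L \geq 0$, set $Z^{+L} = \{x \in X \mid d(x,Z) \leq L\}$. A subset is $k$-connected if any two of its points are joined by a finite chain of points of the subset with consecutive points at distance $\leq k$; $k$-coarsely connected components are maximal $k$-connected subsets. A collection $\mathcal{A}$ of subspaces of $X$ is coarsely separated by a collection $\mathcal{Z}$ of subspaces if there exist $k, L \geq 0$ such that, for every $D \geq 0$, one can find $A \in \mathcal{A}$ and $Z \in \mathcal{Z}$ such that $A$ is $k$-connected and $A \setminus Z^{+L}$ has at least two $k$-coarsely connected components with points at distance $\geq D$ from $Z$. A subspace $Y$ is coarsely separated by $\mathcal{Z}$ if the collection $\{Y\}$ is; it is coarsely separable by a family of subexponential growth if it is coarsely separated by some $\mathcal{Z}$ of subexponential growth. That the subspaces in $\mathcal{A}$ are uniformly not coarsely separable by families of subexponential growth is understood as: no family of subspaces of subexponential growth coarsely separates the collection $\mathcal{A}$.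 Growth. For a family $\mathcal{S}$ of subsets of $X$, set $V_{\mathcal{S}}(R) = \sup_{s \in S,\, S \in \mathcal{S}} |B_X(s,R) \cap S|$, where $B_X(s,R)$ is the closed ball (this definition is formulated for $X$ a graph of bounded degree). The family has exponential growth if $\limsup_{r \to \infty} \frac{1}{r} \log V_{\mathcal{S}}(r) > 0$, and subexponential growth otherwise. A single subspace $B$ has exponential growth if the family $\{B\}$ does.
   Formalization: X is taken to be the vertex set of a connected graph of bounded degree with its path metric (the setting of the growth definition), and the subspaces in A are assumed k-connected for one common k; without these assumptions the statement is false. *)

theory Defs
  imports "HOL-Analysis.Analysis"
begin

section \<open>Graphs of bounded degree as metric spaces\<close>

text \<open>
  A graph is given by its vertex set, which is the underlying type, and a symmetric irreflexive
  adjacency relation. The relational power \<open>(E ^^ n) x y\<close> says that there is a walk of length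
  \<open>n\<close> from \<open>x\<close> to \<open>y\<close>.
\<close>

definition bounded_degree_graph :: "('a \<Rightarrow> 'a \<Rightarrow> bool) \<Rightarrow> bool" where
  "bounded_degree_graph E \<longleftrightarrow> symp E \<and> irreflp E \<and>
     (\<exists>d::nat. \<forall>x. finite {y. E x y} \<and> card {y. E x y} \<le> d)"

definition path_metric_of :: "('a::metric_space \<Rightarrow> 'a \<Rightarrow> bool) \<Rightarrow> bool" where
  "path_metric_of E \<longleftrightarrow>
     (\<forall>x y. (\<exists>n. (E ^^ n) x y) \<and> dist x y = real (LEAST n. (E ^^ n) x y))"


section \<open>Thickness\<close>

text \<open>The list \<open>As\<close> below is the sequence \<open>A\<^sub>1, \<dots>, A\<^sub>n\<close>, indexed from \<open>0\<close>.\<close>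

definition thick :: "'a set set \<Rightarrow> 'a set set \<Rightarrow> 'a set \<Rightarrow> bool" where
  "thick \<A> \<B> E \<longleftrightarrow>
     (\<forall>x\<in>E. \<forall>y\<in>E. \<exists>As. As \<noteq> [] \<and> set As \<subseteq> \<A> \<and> x \<in> hd As \<and> y \<in> last As \<and>
        (\<forall>i. Suc i < length As \<longrightarrow> (\<exists>B\<in>\<B>. B \<subseteq> As ! i \<inter> As ! Suc i)))"


section \<open>Coarse separation\<close>

text \<open>
  The distance from a point to a set is \<^const>\<open>infdist\<close>, for which \<open>infdist x {} = 0\<close>. So
  \<open>nbhd {} L\<close> is the whole space and \<open>Z = {}\<close> never witnesses coarse separation below.
  The convention that the distance to the empty set is infinite gives the same:
  then nothing is removed from \<open>A\<close>, which is \<open>k\<close>-connected and so has at most one component.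
\<close>

definition nbhd :: "'a::metric_space set \<Rightarrow> real \<Rightarrow> 'a set" where
  "nbhd Z L = {x. infdist x Z \<le> L}"

definition k_connected :: "real \<Rightarrow> 'a::metric_space set \<Rightarrow> bool" where
  "k_connected k S \<longleftrightarrow>
     (\<forall>x\<in>S. \<forall>y\<in>S. (\<lambda>a b. a \<in> S \<and> b \<in> S \<and> dist a b \<le> k)\<^sup>*\<^sup>* x y)"

definition coarse_components :: "real \<Rightarrow> 'a::metric_space set \<Rightarrow> 'a set set" where
  "coarse_components k S =
     {C. C \<subseteq> S \<and> k_connected k C \<and> (\<forall>C'. C \<subseteq> C' \<and> C' \<subseteq> S \<and> k_connected k C' \<longrightarrow> C' = C)}"

definition coarsely_separated :: "'a::metric_space set set \<Rightarrow> 'a set set \<Rightarrow> bool" where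
  "coarsely_separated \<A> \<Z> \<longleftrightarrow>
     (\<exists>k\<ge>0. \<exists>L\<ge>0. \<forall>D\<ge>0. \<exists>A\<in>\<A>. \<exists>Z\<in>\<Z>. k_connected k A \<and>
        (\<exists>C\<^sub>1\<in>coarse_components k (A - nbhd Z L). \<exists>C\<^sub>2\<in>coarse_components k (A - nbhd Z L).
           C\<^sub>1 \<noteq> C\<^sub>2 \<and> (\<exists>x\<in>C\<^sub>1. infdist x Z \<ge> D) \<and> (\<exists>y\<in>C\<^sub>2. infdist y Z \<ge> D)))"


section \<open>Growth\<close>

text \<open>
  Cardinalities are taken in the extended nonnegative reals, so that an infinite set counts as
  \<open>\<infinity>\<close> and the supremum always exists; the supremum over an empty family is \<open>0\<close>.
\<close>

definition growth :: "'a::metric_space set set \<Rightarrow> real \<Rightarrow> ennreal" where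
  "growth \<S> R = (SUP S\<in>\<S>. SUP s\<in>S. emeasure (count_space UNIV) (cball s R \<inter> S))"

definition log_ennreal :: "ennreal \<Rightarrow> ereal" where
  "log_ennreal v = (if v = 0 then -\<infinity> else if v = \<infinity> then \<infinity> else ereal (ln (enn2real v)))"

definition exponential_growth :: "'a::metric_space set set \<Rightarrow> bool" where
  "exponential_growth \<S> \<longleftrightarrow>
     Limsup at_top (\<lambda>r::real. ereal (1 / r) * log_ennreal (growth \<S> r)) > 0"

abbreviation subexponential_growth :: "'a::metric_space set set \<Rightarrow> bool" where
  "subexponential_growth \<S> \<equiv> \<not> exponential_growth \<S>"

definition coarsely_separable_subexp :: "'a::metric_space set set \<Rightarrow> bool" where
  "coarsely_separable_subexp \<A> \<longleftrightarrow> (\<exists>\<Z>. subexponential_growth \<Z> \<and> coarsely_separated \<A> \<Z>)"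

end

theory Submission
  imports Defs
begin

text \<open>
  Call the distance of a point to \<open>Z\<close> its depth. Suppose that a family \<open>\<Z>\<close> of subexponential
  growth coarsely separates the graph, with constants \<open>k\<close> and \<open>L\<close>. The family \<open>\<Z>\<close> does not
  coarsely separate \<open>\<A>\<close>, and this may be used for whatever constants are convenient: a step length
  \<open>k'\<close> for which every \<open>A \<in> \<A>\<close> is connected, and the radius \<open>L' = L + k'\<close>. It provides a depth
  \<open>D\<close> such that, for all \<open>A \<in> \<A>\<close> and \<open>Z \<in> \<Z>\<close>, any two points of \<open>A\<close> of depth at least \<open>D\<close> are
  joined by a \<open>k'\<close>-chain in \<open>A\<close> whose points have depth more than \<open>L'\<close>
  (\<open>chain_between_deep_points\<close>). Filling each jump of this chain by a geodesic of the graph costs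
  at most \<open>k'\<close> in depth, hence gives a chain in the complement of \<open>nbhd Z L\<close>
  (\<open>refine_chain\<close>).

  On the other hand a set \<open>B\<close> of exponential growth does not lie in any neighbourhood
  of a member \<open>Z\<close> of \<open>\<Z>\<close>: balls of a fixed radius have boundedly many points, so \<open>B\<close> would
  grow at most as fast as \<open>Z\<close> up to a constant factor and a shift of the radius
  (\<open>exponential_growth_not_subset_nbhd\<close>). So every \<open>B \<in> \<B>\<close> has points as deep as desired.

  Now take \<open>Z \<in> \<Z>\<close> and very deep points \<open>x\<close>, \<open>y\<close> in distinct components of the complement of
  \<open>nbhd Z L\<close>. Thickness joins them by a sequence \<open>A\<^sub>1, \<dots>, A\<^sub>n\<close>; the intersections of consecutive members
  contain deep points, and moving from \<open>x\<close> through these to \<open>y\<close>, one \<open>A\<^sub>i\<close> at a time, never leaves the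
  component of \<open>x\<close>. This is a contradiction.
\<close>

section \<open>Chains and coarse components\<close>

abbreviation k_chain :: "real \<Rightarrow> 'a::metric_space set \<Rightarrow> 'a \<Rightarrow> 'a \<Rightarrow> bool" where
  "k_chain k S \<equiv> (\<lambda>a b. a \<in> S \<and> b \<in> S \<and> dist a b \<le> k)\<^sup>*\<^sup>*"

lemma k_chain_mono:
  assumes "k_chain k S x y" "k \<le> k'" "S \<subseteq> S'"
  shows "k_chain k' S' x y"
  using assms(1) by (rule rtranclp_mono[THEN predicate2D, rotated]) (use assms(2,3) in auto)

lemma k_chain_sym: "k_chain k S x y \<Longrightarrow> k_chain k S y x"
  by (induction rule: rtranclp_induct)
    (auto simp: dist_commute intro: converse_rtranclp_into_rtranclp)

lemma k_chain_in: "k_chain k S x y \<Longrightarrow> x \<in> S \<Longrightarrow> y \<in> S"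
  by (induction rule: rtranclp_induct) auto

lemma k_connected_mono: "k_connected k S \<Longrightarrow> k \<le> k' \<Longrightarrow> k_connected k' S"
  unfolding k_connected_def by (intro ballI, rule k_chain_mono) auto

lemma k_chain_within_class:
  assumes "k_chain k S x y"
  shows "k_chain k {z. k_chain k S x z} x y"
  using assms
proof (induction rule: rtranclp_induct)
  case (step y z)
  have "k_chain k S x z"
    using step.hyps by (rule rtranclp.rtrancl_into_rtrancl)
  with step show ?case
    by (intro rtranclp.rtrancl_into_rtrancl[OF step.IH]) auto
qed simp

lemma k_connected_class: "k_connected k {z. k_chain k S x z}"
  unfolding k_connected_def
proof (intro ballI)
  fix y z assume "y \<in> {z. k_chain k S x z}" "z \<in> {z. k_chain k S x z}"
  then have "k_chain k S x y" "k_chain k S x z" by simp_all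
  then show "k_chain k {z. k_chain k S x z} y z"
    by (rule rtranclp_trans[OF k_chain_sym[OF k_chain_within_class] k_chain_within_class])
qed

lemma coarse_component_eq_class:
  assumes "C \<in> coarse_components k S" "x \<in> C"
  shows "C = {z. k_chain k S x z}"
proof -
  have C: "C \<subseteq> S" "k_connected k C"
    "\<And>C'. C \<subseteq> C' \<Longrightarrow> C' \<subseteq> S \<Longrightarrow> k_connected k C' \<Longrightarrow> C' = C"
    using assms(1) by (auto simp: coarse_components_def)
  have "C \<subseteq> {z. k_chain k S x z}"
  proof
    fix z assume "z \<in> C"
    then have "k_chain k C x z" using C(2) assms(2) unfolding k_connected_def by blast
    then have "k_chain k S x z" by (rule k_chain_mono) (use C(1) in auto)
    then show "z \<in> {z. k_chain k S x z}" by simp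
  qed
  moreover have "{z. k_chain k S x z} \<subseteq> S"
    using C(1) assms(2) by (auto dest: k_chain_in)
  ultimately show ?thesis
    using C(3)[OF _ _ k_connected_class[of k S x]] by simp
qed

lemma class_in_coarse_components:
  assumes "x \<in> S"
  shows "{z. k_chain k S x z} \<in> coarse_components k S"
proof -
  have "C' \<subseteq> {z. k_chain k S x z}"
    if "{z. k_chain k S x z} \<subseteq> C'" "C' \<subseteq> S" "k_connected k C'" for C'
  proof
    fix y assume "y \<in> C'"
    moreover have "x \<in> C'" using that(1) by auto
    ultimately have "k_chain k C' x y"
      using that(3) unfolding k_connected_def by blast
    then have "k_chain k S x y" by (rule k_chain_mono) (use that(2) in auto)
    then show "y \<in> {z. k_chain k S x z}" by simp
  qed
  moreover have "{z. k_chain k S x z} \<subseteq> S" using assms by (auto dest: k_chain_in)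
  ultimately show ?thesis
    unfolding coarse_components_def using k_connected_class[of k S x] by blast
qed

text \<open>
  The form in which the absence of coarse separation is used: beyond a uniform depth, all points
  of a member of \<open>\<A>\<close> lie in a single component of the complement.
\<close>

lemma chain_between_deep_points:
  fixes \<A> \<Z> :: "'a::metric_space set set"
  assumes "\<not> coarsely_separated \<A> \<Z>" "0 \<le> k" "0 \<le> L" "\<forall>A\<in>\<A>. k_connected k A"
  obtains D where "\<And>A Z a b. \<lbrakk>A \<in> \<A>; Z \<in> \<Z>; a \<in> A; b \<in> A; D \<le> infdist a Z; D \<le> infdist b Z\<rbrakk>
    \<Longrightarrow> k_chain k (A - nbhd Z L) a b"
proof -
  define sep where "sep A Z D \<longleftrightarrow> k_connected k A \<and>
      (\<exists>C\<^sub>1\<in>coarse_components k (A - nbhd Z L). \<exists>C\<^sub>2\<in>coarse_components k (A - nbhd Z L).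
         C\<^sub>1 \<noteq> C\<^sub>2 \<and> (\<exists>x\<in>C\<^sub>1. infdist x Z \<ge> D) \<and> (\<exists>y\<in>C\<^sub>2. infdist y Z \<ge> D))" for A Z :: "'a set" and D
  have "\<not> (\<forall>D\<ge>0. \<exists>A\<in>\<A>. \<exists>Z\<in>\<Z>. sep A Z D)"
  proof
    assume "\<forall>D\<ge>0. \<exists>A\<in>\<A>. \<exists>Z\<in>\<Z>. sep A Z D"
    then have "coarsely_separated \<A> \<Z>"
      unfolding coarsely_separated_def sep_def
      by (intro exI[of _ k] exI[of _ L] conjI assms(2,3))
    with assms(1) show False ..
  qed
  then obtain D where D: "\<And>A Z. A \<in> \<A> \<Longrightarrow> Z \<in> \<Z> \<Longrightarrow> \<not> sep A Z D" by blast
  show ?thesis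
  proof (rule that[of "max D (L + 1)"])
    fix A Z a b
    assume AZ: "A \<in> \<A>" "Z \<in> \<Z>" "a \<in> A" "b \<in> A"
      and "max D (L + 1) \<le> infdist a Z" "max D (L + 1) \<le> infdist b Z"
    then have deep: "D \<le> infdist a Z" "D \<le> infdist b Z"
      and out: "a \<in> A - nbhd Z L" "b \<in> A - nbhd Z L" by (auto simp: nbhd_def)
    define C where "C p = {z. k_chain k (A - nbhd Z L) p z}" for p
    have comp: "C p \<in> coarse_components k (A - nbhd Z L)" if "p \<in> A - nbhd Z L" for p
      unfolding C_def using that by (rule class_in_coarse_components)
    have in_C: "p \<in> C p" for p by (simp add: C_def)
    have "C a = C b"
    proof (rule ccontr)
      assume "C a \<noteq> C b"
      then have "sep A Z D"
        unfolding sep_def using assms(4) AZ(1) deep in_C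
        by (intro conjI bexI[OF _ comp[OF out(1)]] bexI[OF _ comp[OF out(2)]]) blast+
      with D[OF AZ(1,2)] show False ..
    qed
    then have "b \<in> C a" using in_C[of b] by simp
    then show "k_chain k (A - nbhd Z L) a b" by (simp add: C_def)
  qed
qed

section \<open>Walks in a graph\<close>

lemma dist_le_of_walk:
  assumes "path_metric_of E" "(E ^^ n) x y"
  shows "dist x y \<le> real n"
  using assms by (auto simp: path_metric_of_def intro: Least_le)

lemma geodesic_walk:
  assumes "path_metric_of E"
  obtains n where "(E ^^ n) x y" "dist x y = real n"
  using assms unfolding path_metric_of_def by (metis LeastI)

text \<open>
  Distances are integers, so chains with steps shorter than \<open>1\<close> are constant. Hence the step length
  \<open>k\<close> of a coarse separation suffices for the unit steps of walks.
\<close>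

lemma k_connected_UNIV_imp_ge_1:
  fixes E :: "'a::metric_space \<Rightarrow> 'a \<Rightarrow> bool"
  assumes "path_metric_of E" "k_connected k (UNIV :: 'a set)" "x \<noteq> (y :: 'a)"
  shows "1 \<le> k"
proof (rule ccontr)
  assume "\<not> 1 \<le> k"
  have eq: "a = b" if "dist a b \<le> k" for a b :: 'a
  proof -
    obtain n where "dist a b = real n" using geodesic_walk[OF assms(1)] by metis
    then have "dist a b = 0" using that \<open>\<not> 1 \<le> k\<close> by (cases n) auto
    then show ?thesis by simp
  qed
  have "k_chain k UNIV x y" using assms(2) by (auto simp: k_connected_def)
  then have "x = y" by (induction rule: rtranclp_induct) (auto dest: eq)
  with assms(3) show False by simp
qed

text \<open>
  A walk loses at most one unit of distance to \<open>Z\<close> per edge, so a walk of length \<open>n\<close> that starts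
  deeper than \<open>L + n\<close> stays outside the \<open>L\<close>-neighbourhood.
\<close>

lemma walk_avoids_nbhd:
  fixes E :: "'a::metric_space \<Rightarrow> 'a \<Rightarrow> bool"
  assumes "path_metric_of E" "(E ^^ n) a b" "L + real n < infdist a Z"
  shows "k_chain 1 (UNIV - nbhd Z L) a b"
  using assms(2,3)
proof (induction n arbitrary: a)
  case (Suc n)
  obtain c where c: "E a c" "(E ^^ n) c b"
    using relpowp_Suc_D2[OF Suc.prems(1)] by blast
  have "dist a c \<le> 1"
    using dist_le_of_walk[OF assms(1), of 1 a c] c(1) by (simp only: relpowp_1 of_nat_1)
  moreover from this have "L + real n < infdist c Z"
    using infdist_triangle[of a Z c] Suc.prems(2) by simp
  moreover from this have "k_chain 1 (UNIV - nbhd Z L) c b"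
    using Suc.IH c(2) by blast
  ultimately show ?case
    using Suc.prems(2)
    by (intro converse_rtranclp_into_rtranclp[of _ a c b]) (auto simp: nbhd_def)
qed simp

text \<open>
  Each jump has length at most \<open>k\<close>, so a geodesic walk along it meets the hypothesis of
  \<open>walk_avoids_nbhd\<close>: this is the reason for the extra \<open>k\<close> in the radius.
\<close>

lemma refine_chain:
  fixes E :: "'a::metric_space \<Rightarrow> 'a \<Rightarrow> bool" and a b :: 'a
  assumes "path_metric_of E" "k_chain k (A - nbhd Z (L + k)) a b"
  shows "k_chain 1 (UNIV - nbhd Z L) a b"
  using assms(2)
proof (induction rule: rtranclp_induct)
  case (step b c)
  obtain n where n: "(E ^^ n) b c" "dist b c = real n"
    using geodesic_walk[OF assms(1)] by metis
  have "k_chain 1 (UNIV - nbhd Z L) b c"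
    using step.hyps(2) n(2) by (intro walk_avoids_nbhd[OF assms(1) n(1)]) (auto simp: nbhd_def)
  with step.IH show ?case by (rule rtranclp_trans)
qed simp

lemma finite_card_walk_ends:
  fixes E :: "'a \<Rightarrow> 'a \<Rightarrow> bool"
  assumes "\<And>x. finite {y. E x y} \<and> card {y. E x y} \<le> d"
  shows "finite {y. (E ^^ n) x y} \<and> card {y. (E ^^ n) x y} \<le> d ^ n"
proof (induction n arbitrary: x)
  case (Suc n)
  have eq: "{y. (E ^^ Suc n) x y} = (\<Union>c\<in>{c. E x c}. {y. (E ^^ n) c y})"
    by (blast intro: relpowp_Suc_I2 dest: relpowp_Suc_D2)
  have "card (\<Union>c\<in>{c. E x c}. {y. (E ^^ n) c y}) \<le> (\<Sum>c\<in>{c. E x c}. card {y. (E ^^ n) c y})"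
    using assms by (intro card_UN_le) auto
  also have "\<dots> \<le> (\<Sum>c\<in>{c. E x c}. d ^ n)" using Suc by (intro sum_mono) auto
  also have "\<dots> \<le> d * d ^ n" using assms by (simp add: mult_right_mono)
  finally show ?case unfolding eq using assms Suc by auto
qed (simp add: Collect_conv_if)

lemma bounded_degree_cball:
  fixes E :: "'a::metric_space \<Rightarrow> 'a \<Rightarrow> bool"
  assumes "bounded_degree_graph E" "path_metric_of E"
  obtains N where "\<And>x::'a. finite (cball x R)" "\<And>x::'a. card (cball x R) \<le> N"
proof -
  obtain d where d: "\<And>x. finite {y. E x y} \<and> card {y. E x y} \<le> d"
    using assms(1) by (auto simp: bounded_degree_graph_def)
  define W where "W x = (\<Union>n\<le>nat \<lfloor>R\<rfloor>. {y. (E ^^ n) x y})" for x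
  have sub: "cball x R \<subseteq> W x" for x
  proof
    fix y assume "y \<in> cball x R"
    moreover obtain n where n: "(E ^^ n) x y" "dist x y = real n"
      using geodesic_walk[OF assms(2)] by metis
    ultimately have "n \<le> nat \<lfloor>R\<rfloor>" by (simp add: le_nat_floor)
    then show "y \<in> W x" using n(1) by (auto simp: W_def)
  qed
  have fin: "finite (W x)" for x
    using finite_card_walk_ends[of E, OF d] by (auto simp: W_def)
  have "card (W x) \<le> (\<Sum>n\<le>nat \<lfloor>R\<rfloor>. d ^ n)" for x
  proof -
    have "card (W x) \<le> (\<Sum>n\<le>nat \<lfloor>R\<rfloor>. card {y. (E ^^ n) x y})"
      unfolding W_def by (intro card_UN_le) auto
    also have "\<dots> \<le> (\<Sum>n\<le>nat \<lfloor>R\<rfloor>. d ^ n)"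
      using finite_card_walk_ends[of E, OF d] by (intro sum_mono) auto
    finally show ?thesis .
  qed
  with sub fin show ?thesis
    by (intro that[of "\<Sum>n\<le>nat \<lfloor>R\<rfloor>. d ^ n"]) (meson finite_subset card_mono le_trans)+
qed

section \<open>Comparison of growth\<close>

lemma log_ennreal_le_iff:
  assumes "0 < r"
  shows "ereal (1 / r) * log_ennreal v \<le> ereal \<epsilon> \<longleftrightarrow> v \<le> ennreal (exp (\<epsilon> * r))"
proof (cases v)
  case (real t)
  show ?thesis
  proof (cases "t = 0")
    case False
    then have "0 < t" using real by simp
    then have "ereal (1 / r) * log_ennreal v \<le> ereal \<epsilon> \<longleftrightarrow> ln t \<le> \<epsilon> * r"
      using real assms by (simp add: log_ennreal_def field_simps)
    also have "\<dots> \<longleftrightarrow> t \<le> exp (\<epsilon> * r)"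
      using \<open>0 < t\<close> by (metis exp_le_cancel_iff exp_ln)
    also have "\<dots> \<longleftrightarrow> v \<le> ennreal (exp (\<epsilon> * r))"
      using real by (simp add: ennreal_le_iff)
    finally show ?thesis .
  qed (use real assms in \<open>simp add: log_ennreal_def\<close>)
qed (use assms in \<open>simp add: log_ennreal_def top_unique\<close>)

text \<open>
  This removes logarithms and upper limits from the definition of growth, so that constant factors
  and shifts of the radius can be absorbed by enlarging \<open>\<epsilon>\<close>.
\<close>

lemma subexponential_growth_iff:
  "subexponential_growth \<S> \<longleftrightarrow>
     (\<forall>\<epsilon>>0. eventually (\<lambda>r. growth \<S> r \<le> ennreal (exp (\<epsilon> * r))) at_top)"
    (is "_ \<longleftrightarrow> ?R")
proof -
  let ?f = "\<lambda>r::real. ereal (1 / r) * log_ennreal (growth \<S> r)"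
  have "subexponential_growth \<S> \<longleftrightarrow> (\<forall>y>0. eventually (\<lambda>r. ?f r < y) at_top)"
    by (simp add: exponential_growth_def not_less Limsup_le_iff)
  also have "\<dots> \<longleftrightarrow> (\<forall>\<epsilon>>0. eventually (\<lambda>r. ?f r \<le> ereal \<epsilon>) at_top)"
  proof safe
    fix \<epsilon> :: real
    assume "\<forall>y>0. eventually (\<lambda>r. ?f r < y) at_top" "0 < \<epsilon>"
    then have "eventually (\<lambda>r. ?f r < ereal \<epsilon>) at_top" by simp
    then show "eventually (\<lambda>r. ?f r \<le> ereal \<epsilon>) at_top"
      by (rule eventually_mono) simp
  next
    fix y :: ereal
    assume *: "\<forall>\<epsilon>>0. eventually (\<lambda>r. ?f r \<le> ereal \<epsilon>) at_top" and "0 < y"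
    obtain \<epsilon> where "0 < ereal \<epsilon>" "ereal \<epsilon> < y" using ereal_dense2[OF \<open>0 < y\<close>] by auto
    with * have "eventually (\<lambda>r. ?f r \<le> ereal \<epsilon>) at_top" by simp
    then show "eventually (\<lambda>r. ?f r < y) at_top"
      by (rule eventually_mono) (use \<open>ereal \<epsilon> < y\<close> in simp)
  qed
  also have "\<dots> \<longleftrightarrow> ?R"
  proof -
    have "eventually (\<lambda>r. ?f r \<le> ereal \<epsilon>) at_top \<longleftrightarrow>
        eventually (\<lambda>r. growth \<S> r \<le> ennreal (exp (\<epsilon> * r))) at_top" for \<epsilon>
      by (rule eventually_cong[OF eventually_gt_at_top[of 0]]) (rule log_ennreal_le_iff)
    then show ?thesis by simp
  qed
  finally show ?thesis .
qed

lemma subexponential_growth_transfer: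
  assumes sub: "subexponential_growth \<S>"
    and le: "\<And>R. growth \<T> R \<le> ennreal C * growth \<S> (R + c)"
  shows "subexponential_growth \<T>"
  unfolding subexponential_growth_iff
proof safe
  fix \<epsilon> :: real assume "0 < \<epsilon>"
  \<comment> \<open>One half of \<open>\<epsilon>\<close> bounds \<open>\<S>\<close>; the other half absorbs \<open>C\<close> and \<open>c\<close> for large \<open>r\<close>.\<close>
  define C' where "C' = max 1 C"
  have "eventually (\<lambda>r. growth \<S> r \<le> ennreal (exp (\<epsilon> / 2 * r))) at_top"
    using sub \<open>0 < \<epsilon>\<close> unfolding subexponential_growth_iff by (metis half_gt_zero)
  then have "eventually (\<lambda>r. growth \<S> (r + c) \<le> ennreal (exp (\<epsilon> / 2 * (r + c)))) at_top"
    using eventually_compose_filterlim[OF _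
        filterlim_tendsto_add_at_top[OF tendsto_const[of c] filterlim_ident]]
    by (force simp: add.commute)
  moreover have "eventually (\<lambda>r. 2 * ln C' / \<epsilon> + c \<le> r) at_top"
    by (rule eventually_ge_at_top)
  ultimately show "eventually (\<lambda>r. growth \<T> r \<le> ennreal (exp (\<epsilon> * r))) at_top"
  proof eventually_elim
    case (elim r)
    have "growth \<T> r \<le> ennreal C' * ennreal (exp (\<epsilon> / 2 * (r + c)))"
      by (rule order.trans[OF le]) (use elim in \<open>auto simp: C'_def intro!: mult_mono ennreal_leI\<close>)
    also have "\<dots> = ennreal (exp (ln C' + \<epsilon> / 2 * (r + c)))"
      by (simp add: C'_def exp_add ennreal_mult)
    also have "\<dots> \<le> ennreal (exp (\<epsilon> * r))"
      using elim(2) \<open>0 < \<epsilon>\<close> by (intro ennreal_leI) (simp add: field_simps)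
    finally show ?case .
  qed
qed

text \<open>
  Send each point of \<open>B\<close> to a nearby point of \<open>Z\<close>. The points of \<open>B\<close> in a ball of radius \<open>R\<close> land in
  a ball of \<open>Z\<close> of slightly larger radius, and no more than \<open>N\<close> of them land at the same point.
\<close>

lemma growth_le_of_subset_nbhd:
  fixes E :: "'a::metric_space \<Rightarrow> 'a \<Rightarrow> bool" and B Z :: "'a set"
  assumes "bounded_degree_graph E" "path_metric_of E"
    and "Z \<in> \<Z>" "Z \<noteq> {}" "B \<subseteq> nbhd Z M"
  obtains N c where "\<And>R. growth {B} R \<le> ennreal N * growth \<Z> (R + c)"
proof -
  \<comment> \<open>The infimum defining \<open>infdist\<close> need not be attained, whence the enlarged radius.\<close>
  define m where "m = M + 1"
  obtain N where N: "\<And>x::'a. card (cball x m) \<le> N"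
    using bounded_degree_cball[OF assms(1,2)] by metis
  have fin: "finite (cball x R)" for x :: 'a and R
    using bounded_degree_cball[OF assms(1,2)] by metis
  have near: "\<exists>z\<in>Z. dist z p \<le> m" if "p \<in> B" for p
  proof -
    have "infdist p Z < m" using that assms(5) by (auto simp: nbhd_def m_def)
    then obtain z where "z \<in> Z" "dist p z < m"
      using assms(4) by (auto simp: infdist_notempty cInf_less_iff)
    then show ?thesis by (auto simp: dist_commute intro!: bexI[of _ z])
  qed
  have "growth {B} R \<le> ennreal N * growth \<Z> (R + 2 * m)" for R
    unfolding growth_def[of "{B}"]
  proof (clarsimp intro!: SUP_least)
    fix b assume "b \<in> B"
    then obtain z0 where z0: "z0 \<in> Z" "dist z0 b \<le> m" using near by blast
    let ?T = "cball z0 (R + 2 * m) \<inter> Z"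
    have "cball b R \<inter> B \<subseteq> (\<Union>z\<in>?T. cball z m)"
    proof
      fix p assume p: "p \<in> cball b R \<inter> B"
      then obtain z where z: "z \<in> Z" "dist z p \<le> m" using near by blast
      have "dist z0 z \<le> dist z0 b + dist b p + dist p z"
        using dist_triangle[of z0 z b] dist_triangle[of b z p] by simp
      with z z0 p show "p \<in> (\<Union>z\<in>?T. cball z m)"
        by (intro UN_I[of z]) (auto simp: dist_commute)
    qed
    then have "card (cball b R \<inter> B) \<le> card (\<Union>z\<in>?T. cball z m)"
      using fin by (intro card_mono finite_UN_I finite_Int) auto
    also have "\<dots> \<le> (\<Sum>z\<in>?T. card (cball z m))"
      using fin by (intro card_UN_le) auto
    also have "\<dots> \<le> card ?T * N" using N sum_bounded_above[of ?T _ N] by simp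
    finally have "card (cball b R \<inter> B) \<le> N * card ?T" by (simp add: mult.commute)
    then have "emeasure (count_space UNIV) (cball b R \<inter> B)
        \<le> ennreal N * emeasure (count_space UNIV) ?T"
      using fin[of b R] fin[of z0]
      by (simp add: emeasure_count_space_finite ennreal_of_nat_eq_real_of_nat
          flip: ennreal_mult of_nat_mult)
    also have "emeasure (count_space UNIV) ?T \<le> growth \<Z> (R + 2 * m)"
      unfolding growth_def using assms(3) z0(1) by (auto intro!: SUP_upper2)
    finally show "emeasure (count_space UNIV) (cball b R \<inter> B) \<le> ennreal N * growth \<Z> (R + 2 * m)"
      by (simp add: mult_left_mono)
  qed
  then show ?thesis by (rule that)
qed

lemma exponential_growth_not_subset_nbhd:
  fixes E :: "'a::metric_space \<Rightarrow> 'a \<Rightarrow> bool" and B Z :: "'a set"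
  assumes "bounded_degree_graph E" "path_metric_of E"
    and "subexponential_growth \<Z>" "Z \<in> \<Z>" "Z \<noteq> {}" "exponential_growth {B}"
  shows "\<not> B \<subseteq> nbhd Z M"
  using growth_le_of_subset_nbhd[OF assms(1,2,4,5)] subexponential_growth_transfer[OF assms(3)]
    assms(6) by metis

section \<open>Thick spaces\<close>

text \<open>
  A transitive relation spreads along the sequences given by thickness as soon as it holds
  between the marked points of each \<open>A\<close>, and each \<open>B\<close> contains a marked point through which
  one can pass from one member of the sequence to the next.
\<close>

lemma thick_sequence_induct:
  assumes "As \<noteq> []" "set As \<subseteq> \<A>" "x \<in> hd As" "y \<in> last As"
    and "\<forall>i. Suc i < length As \<longrightarrow> (\<exists>B\<in>\<B>. B \<subseteq> As ! i \<inter> As ! Suc i)"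
    and marked: "P x" "P y" "\<And>B. B \<in> \<B> \<Longrightarrow> \<exists>b\<in>B. P b"
    and within: "\<And>A a b. A \<in> \<A> \<Longrightarrow> a \<in> A \<Longrightarrow> b \<in> A \<Longrightarrow> P a \<Longrightarrow> P b \<Longrightarrow> Q a b"
    and "transp Q"
  shows "Q x y"
  using assms(1-5) \<open>P x\<close>
proof (induction As arbitrary: x)
  case (Cons A As)
  show ?case
  proof (cases As)
    case Nil
    then show ?thesis using Cons.prems within \<open>P y\<close> by auto
  next
    case (Cons A' As')
    obtain B where "B \<in> \<B>" "B \<subseteq> A \<inter> A'"
      using Cons.prems(5)[rule_format, of 0] Cons by auto
    then obtain b where b: "b \<in> A" "b \<in> A'" "P b" using marked(3) by blast
    have "Q x b" using within Cons.prems b by auto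
    moreover have "Q b y"
    proof (rule Cons.IH)
      show "\<forall>i. Suc i < length As \<longrightarrow> (\<exists>B\<in>\<B>. B \<subseteq> As ! i \<inter> As ! Suc i)"
        using Cons.prems(5) by (metis Suc_less_eq length_Cons nth_Cons_Suc)
    qed (use Cons.prems Cons b in auto)
    ultimately show ?thesis using \<open>transp Q\<close> by (meson transpD)
  qed
qed simp

theorem proposition1p6:
  fixes E :: "'a::metric_space \<Rightarrow> 'a \<Rightarrow> bool"
    and \<A> \<B> :: "'a set set"
  assumes "bounded_degree_graph E" and "path_metric_of E"
    and "thick \<A> \<B> UNIV"
    and "\<exists>k. \<forall>A\<in>\<A>. k_connected k A"
    and "\<not> coarsely_separable_subexp \<A>"
    and "\<forall>B\<in>\<B>. exponential_growth {B}"
  shows "\<not> coarsely_separable_subexp {UNIV :: 'a set}"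
proof
  assume "coarsely_separable_subexp {UNIV :: 'a set}"
  then obtain \<Z> :: "'a set set" and k L
    where \<Z>: "subexponential_growth \<Z>" and kL: "0 \<le> k" "0 \<le> L"
      and sep: "\<And>D. 0 \<le> D \<Longrightarrow> \<exists>Z\<in>\<Z>. k_connected k (UNIV :: 'a set) \<and>
        (\<exists>C\<^sub>1\<in>coarse_components k (UNIV - nbhd Z L). \<exists>C\<^sub>2\<in>coarse_components k (UNIV - nbhd Z L).
           C\<^sub>1 \<noteq> C\<^sub>2 \<and> (\<exists>x\<in>C\<^sub>1. infdist x Z \<ge> D) \<and> (\<exists>y\<in>C\<^sub>2. infdist y Z \<ge> D))"
    unfolding coarsely_separable_subexp_def coarsely_separated_def by auto
  obtain k0 where k0: "\<forall>A\<in>\<A>. k_connected k0 A" using assms(4) by blast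
  \<comment> \<open>Coarse separation asks for a nonnegative step length, which \<open>k0\<close> need not be.\<close>
  define k' where "k' = max 0 k0"
  have "\<not> coarsely_separated \<A> \<Z>"
    using assms(5) \<Z> by (auto simp: coarsely_separable_subexp_def)
  moreover have "\<forall>A\<in>\<A>. k_connected k' A" using k0 k_connected_mono by (metis k'_def max.cobounded2)
  ultimately obtain D where D: "\<And>A Z a b. \<lbrakk>A \<in> \<A>; Z \<in> \<Z>; a \<in> A; b \<in> A;
      D \<le> infdist a Z; D \<le> infdist b Z\<rbrakk> \<Longrightarrow> k_chain k' (A - nbhd Z (L + k')) a b"
    using chain_between_deep_points[of \<A> \<Z> k' "L + k'"] kL by (auto simp: k'_def)
  obtain Z C\<^sub>1 C\<^sub>2 x y where Z: "Z \<in> \<Z>" and conn: "k_connected k (UNIV :: 'a set)"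
    and C: "C\<^sub>1 \<in> coarse_components k (UNIV - nbhd Z L)"
      "C\<^sub>2 \<in> coarse_components k (UNIV - nbhd Z L)" "C\<^sub>1 \<noteq> C\<^sub>2" "x \<in> C\<^sub>1" "y \<in> C\<^sub>2"
    and "max 0 D \<le> infdist x Z" "max 0 D \<le> infdist y Z"
    using sep[OF max.cobounded1[of 0 D]] by blast
  then have deep: "D \<le> infdist x Z" "D \<le> infdist y Z" by simp_all
  \<comment> \<open>Since \<open>infdist x {} = 0\<close>, the empty set has everything in its neighbourhoods.\<close>
  have "x \<notin> nbhd Z L" using C(1,4) by (auto simp: coarse_components_def)
  then have "Z \<noteq> {}" using kL(2) by (auto simp: nbhd_def infdist_def)
  have no_chain: "\<not> k_chain k (UNIV - nbhd Z L) x y"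
  proof
    assume "k_chain k (UNIV - nbhd Z L) x y"
    then have "y \<in> C\<^sub>1" using coarse_component_eq_class[OF C(1,4)] by blast
    then have "C\<^sub>1 = C\<^sub>2"
      by (rule coarse_component_eq_class[OF C(1), THEN trans])
        (rule coarse_component_eq_class[OF C(2,5), symmetric])
    with C(3) show False ..
  qed
  then have "x \<noteq> y" by auto
  then have "1 \<le> k" using k_connected_UNIV_imp_ge_1[OF assms(2) conn] by blast
  obtain As where As: "As \<noteq> []" "set As \<subseteq> \<A>" "x \<in> hd As" "y \<in> last As"
    "\<forall>i. Suc i < length As \<longrightarrow> (\<exists>B\<in>\<B>. B \<subseteq> As ! i \<inter> As ! Suc i)"
    using assms(3)[unfolded thick_def, THEN bspec[OF _ UNIV_I[of x]], THEN bspec[OF _ UNIV_I[of y]]]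
    by (elim exE conjE)
  have "k_chain k (UNIV - nbhd Z L) x y"
  proof (rule thick_sequence_induct[OF As,
      where P = "\<lambda>p. D \<le> infdist p Z" and Q = "k_chain k (UNIV - nbhd Z L)"])
    fix B assume "B \<in> \<B>"
    then have "\<not> B \<subseteq> nbhd Z D"
      using exponential_growth_not_subset_nbhd[OF assms(1,2) \<Z> Z \<open>Z \<noteq> {}\<close>] assms(6) by blast
    then show "\<exists>b\<in>B. D \<le> infdist b Z" by (force simp: nbhd_def)
  next
    fix A a b
    assume "A \<in> \<A>" "a \<in> A" "b \<in> A" "D \<le> infdist a Z" "D \<le> infdist b Z"
    then have "k_chain 1 (UNIV - nbhd Z L) a b"
      using D Z by (intro refine_chain[OF assms(2)]) auto
    then show "k_chain k (UNIV - nbhd Z L) a b"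
      by (rule k_chain_mono) (use \<open>1 \<le> k\<close> in auto)
  next
    show "transp (k_chain k (UNIV - nbhd Z L))" by (rule transpI) (rule rtranclp_trans)
  qed (use deep in simp_all)
  with no_chain show False ..
qed

end
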